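(* For every finite set $N$ with $|N| = n \ge 5$, the entropy region $\overline{\mathbf{H}_N^{\mathrm{ent}}}$ is not closed under duality: there exists $h \in \overline{\mathbf{H}_N^{\mathrm{ent}}}$ such that $h^\perp \notin \overline{\mathbf{H}_N^{\mathrm{ent}}}$.
   Context: Let $N$ be a finite index set of size $n$. For jointly distributed discrete random variables $(X_i)_{i\in N}$ (with finite support) and $J\subseteq N$, write $X_J=(X_i)_{i\in J}$ and $H(X_J)$ for its Shannon entropy, with $H(X_\varnothing)=0$. The vector $(H(X_J))_{\varnothing\ne J\subseteq N}\in\mathbb{R}^{2^n-1}$ is called an entropic vector; $\mathbf{H}_N^{\mathrm{ent}}$ denotes the set of all entropic vectors and $\overline{\mathbf{H}_N^{\mathrm{ent}}}$ its topological closure (the entropy region; its elements are called almost entropic). Vectors $h\in\mathbb{R}^{2^n-1}$ are viewed as functions on nonempty subsets of $N$, extended by $h(\varnothing)=0$. The dual of $h$ is the vector $h^\perp$ defined by $h^\perp(J) = h(N\setminus J) - h(N) + \sum_{j\in J} h(\{j\})$ for nonempty $J\subseteq N$. *)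

theory Defs
  imports "HOL-Analysis.Analysis" "HOL-Probability.Probability_Mass_Function"
begin

definition shannon_entropy :: "'a pmf \<Rightarrow> real" where
  "shannon_entropy q = - (\<Sum>x\<in>set_pmf q. pmf q x * log 2 (pmf q x))"

text \<open>A joint distribution of random variables (X_i) indexed by the finite type 'n,
  each taking values in nat (any finite alphabet embeds into nat).
  The entropic vector maps J to H(X_J), the entropy of the marginal on J.
  Note H(X_{}) = 0 automatically.\<close>
definition entropic_vector :: "('n \<Rightarrow> nat) pmf \<Rightarrow> 'n set \<Rightarrow> real" where
  "entropic_vector p = (\<lambda>J. shannon_entropy (map_pmf (\<lambda>x. restrict x J) p))"

definition entropic_vectors :: "('n set \<Rightarrow> real) set" where
  "entropic_vectors = {entropic_vector p | p. finite (set_pmf p)}"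

text \<open>Entropy region: topological closure (product topology on 'n set => real,
  a finite-dimensional Euclidean topology since 'n is finite).\<close>
definition entropy_region :: "('n::finite set \<Rightarrow> real) set" where
  "entropy_region = closure entropic_vectors"

definition dual_vec :: "('n::finite set \<Rightarrow> real) \<Rightarrow> 'n set \<Rightarrow> real" where
  "dual_vec h J = h (UNIV - J) - h UNIV + (\<Sum>j\<in>J. h {j})"

end

theory Submission
  imports Defs
begin

text \<open>Five jointly distributed variables satisfy the inequality of Makarychev, Makarychev,
  Romashchenko and Vereshchagin
  I(a:b) \<le> I(a:b|c) + I(a:b|d) + I(c:d) + I(a:b|e) + I(a:e|b) + I(b:e|a).
  Its terms do not see the joint law of e and (c,d), so e may be resampled conditionally on (a,b);
  once e and (c,d) are independent given (a,b), the inequality follows from submodularity of the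
  entropy. Being linear, it extends to the closure.

  The dual of I(x:y|Z) is I(x:y|W), where W is the complement of {x,y} \<union> Z, so the dual inequality
  reads I(a:b|cde) \<le> I(a:b|de) + I(a:b|ce) + I(c:d|abe) + I(a:b|cd) + I(a:e|cd) + I(b:e|cd).
  It fails for a distribution on eight atoms that violates Ingleton's inequality conditionally on e,
  while a, b, e are pairwise independent given (c,d). Further variables are constant.\<close>

section \<open>Marginals and entropies through cylinder events\<close>

text \<open>The fibres of restriction to \<open>J\<close>. With them all marginals of
  \<open>p\<close> become probabilities under \<open>p\<close> itself and can be compared at the
  same point \<open>x\<close>.\<close>

definition cylinder :: "'n set \<Rightarrow> ('n \<Rightarrow> nat) \<Rightarrow> ('n \<Rightarrow> nat) set" where
  "cylinder J x = {y. \<forall>i\<in>J. y i = x i}"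

lemma restrict_eq_iff_cylinder: "restrict y J = restrict x J \<longleftrightarrow> y \<in> cylinder J x"
  by (auto simp: cylinder_def restrict_def fun_eq_iff)

lemma self_in_cylinder [simp]: "x \<in> cylinder J x"
  by (simp add: cylinder_def)

lemma cylinder_cong: "y \<in> cylinder J x \<Longrightarrow> S \<subseteq> J \<Longrightarrow> cylinder S y = cylinder S x"
  by (force simp: cylinder_def)

lemma cylinder_antimono: "S \<subseteq> J \<Longrightarrow> cylinder J x \<subseteq> cylinder S x"
  by (auto simp: cylinder_def)

abbreviation marginal :: "('n \<Rightarrow> nat) pmf \<Rightarrow> 'n set \<Rightarrow> ('n \<Rightarrow> nat) pmf" where
  "marginal p J \<equiv> map_pmf (\<lambda>x. restrict x J) p"

lemma pmf_marginal: "pmf (marginal p J) (restrict x J) = measure p (cylinder J x)"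
  by (simp add: pmf_map vimage_def restrict_eq_iff_cylinder)

lemma prob_cylinder_pos: "x \<in> set_pmf p \<Longrightarrow> 0 < measure p (cylinder J x)"
  by (auto intro: measure_pmf_posI)

lemma shannon_entropy_eq_expectation:
  assumes "finite (set_pmf q)"
  shows "shannon_entropy q = - measure_pmf.expectation q (\<lambda>x. log 2 (pmf q x))"
  using integral_measure_pmf_real[OF assms, of q "\<lambda>x. log 2 (pmf q x)"]
  by (simp add: shannon_entropy_def mult.commute)

text \<open>In this form a pointwise linear identity between log-probabilities yields one between
  entropies.\<close>

lemma entropic_vector_eq_expectation:
  assumes "finite (set_pmf p)"
  shows "entropic_vector p J = - measure_pmf.expectation p (\<lambda>x. log 2 (measure p (cylinder J x)))"
  using assms
  by (simp add: entropic_vector_def shannon_entropy_eq_expectation pmf_marginal)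

section \<open>Conditionally independent gluing of two marginals\<close>

lemma prob_bind_pmf:
  "measure (bind_pmf M N) X = measure_pmf.expectation M (\<lambda>x. measure (N x) X)"
  using measurable_measure_pmf[of N]
  unfolding measure_pmf_bind
  by (subst measure_pmf.measure_bind[where N="count_space UNIV"]) auto

lemma prob_cond_pmf:
  assumes "set_pmf p \<inter> S \<noteq> {}"
  shows "measure (cond_pmf p S) T = measure p (S \<inter> T) / measure p S"
  unfolding cond_pmf.rep_eq[OF assms]
  by (rule measure_uniform_measure) (use assms in \<open>auto simp: emeasure_measure_pmf_not_zero\<close>)

text \<open>The coordinates outside J are resampled conditionally on those in J \<inter> K. This keeps
  the marginals on J and K and makes them independent given J \<inter> K.\<close>
definition glue :: "'n set \<Rightarrow> 'n set \<Rightarrow> ('n \<Rightarrow> nat) pmf \<Rightarrow> ('n \<Rightarrow> nat) pmf" where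
  "glue J K p = bind_pmf p (\<lambda>x. map_pmf (\<lambda>y i. if i \<in> J then x i else y i)
     (cond_pmf p (cylinder (J \<inter> K) x)))"

lemma set_cond_cylinder:
  "x \<in> set_pmf p \<Longrightarrow> set_pmf (cond_pmf p (cylinder S x)) = set_pmf p \<inter> cylinder S x"
  by (rule set_cond_pmf) (use self_in_cylinder in blast)

lemma finite_set_glue: "finite (set_pmf p) \<Longrightarrow> finite (set_pmf (glue J K p))"
  by (auto simp: glue_def set_cond_cylinder)

lemma marginal_glue_left:
  assumes "S \<subseteq> J"
  shows "marginal (glue J K p) S = marginal p S"
proof -
  have "(\<lambda>y. restrict (\<lambda>i. if i \<in> J then x i else y i) S) = (\<lambda>y. restrict x S)" for x :: "'a \<Rightarrow> nat"
    using assms by (auto simp: restrict_def fun_eq_iff)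
  then have "marginal (glue J K p) S = bind_pmf p (\<lambda>x. return_pmf (restrict x S))"
    by (simp add: glue_def map_bind_pmf map_pmf_comp)
  then show ?thesis
    by (simp add: map_pmf_def)
qed

text \<open>Law of total probability, as the cylinders over \<open>S\<close> partition the
  space.\<close>

lemma bind_cond_cylinder: "bind_pmf p (\<lambda>x. cond_pmf p (cylinder S x)) = p"
  unfolding cylinder_def
proof (rule bind_cond_pmf_cancel, goal_cases)
  case (3 x y)
  then have "{y. \<forall>i\<in>S. y i = x i} = {x. \<forall>i\<in>S. y i = x i}"
    by auto
  then show ?case by simp
qed auto

text \<open>On \<open>J \<inter> K\<close> the resampled \<open>y\<close> agrees with
  \<open>x\<close>, so on \<open>K\<close> the glued point is just \<open>y\<close>, whose law
  averaged over \<open>x\<close> is \<open>p\<close>.\<close>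

lemma marginal_glue_right:
  assumes "S \<subseteq> K"
  shows "marginal (glue J K p) S = marginal p S"
proof -
  have agree: "restrict (\<lambda>i. if i \<in> J then x i else y i) S = restrict y S"
    if "y \<in> cylinder (J \<inter> K) x" for x y :: "'a \<Rightarrow> nat"
    using assms that by (auto simp: cylinder_def restrict_def fun_eq_iff)
  have "marginal (glue J K p) S = bind_pmf p (\<lambda>x. marginal (cond_pmf p (cylinder (J \<inter> K) x)) S)"
    unfolding glue_def map_bind_pmf map_pmf_comp
    by (intro bind_pmf_cong map_pmf_cong refl) (auto simp: set_cond_cylinder agree)
  also have "\<dots> = marginal p S"
    by (simp add: bind_cond_cylinder flip: map_bind_pmf)
  finally show ?thesis .
qed

text \<open>The first draw \<open>w\<close> has to agree with \<open>x\<close> on \<open>J\<close>;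
  the second then agrees with \<open>x\<close> on \<open>K\<close> with the conditional probability
  \<open>?c\<close>, the same for all such \<open>w\<close>.\<close>

lemma prob_cylinder_glue:
  "measure (glue J K p) (cylinder (J \<union> K) x) =
     measure p (cylinder J x) * measure p (cylinder K x) / measure p (cylinder (J \<inter> K) x)"
proof -
  let ?c = "measure p (cylinder K x) / measure p (cylinder (J \<inter> K) x)"
  have eq: "measure (map_pmf (\<lambda>y i. if i \<in> J then w i else y i) (cond_pmf p (cylinder (J \<inter> K) w)))
      (cylinder (J \<union> K) x) = ?c * indicator (cylinder J x) w"
    if w: "w \<in> set_pmf p" for w
  proof (cases "w \<in> cylinder J x")
    case True
    have c: "cylinder (J \<inter> K) w = cylinder (J \<inter> K) x"
      using True by (rule cylinder_cong) auto
    have ne: "set_pmf p \<inter> cylinder (J \<inter> K) x \<noteq> {}"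
      using w True cylinder_antimono[of "J \<inter> K" J x] by auto
    have "cylinder (J \<inter> K) x \<inter> (\<lambda>y i. if i \<in> J then w i else y i) -` cylinder (J \<union> K) x = cylinder K x"
      using True by (auto simp: cylinder_def)
    then show ?thesis
      using True ne by (simp add: c prob_cond_pmf)
  next
    case False
    then have "(\<lambda>y i. if i \<in> J then w i else y i) -` cylinder (J \<union> K) x = {}"
      by (auto simp: cylinder_def)
    then show ?thesis using False by simp
  qed
  have "measure (glue J K p) (cylinder (J \<union> K) x) =
      measure_pmf.expectation p (\<lambda>w. ?c * indicator (cylinder J x) w)"
    unfolding glue_def prob_bind_pmf
    by (rule integral_cong_AE) (auto simp: AE_measure_pmf_iff eq simp del: measure_map_pmf)
  then show ?thesis by simp
qed

lemma entropic_vector_glue_eq: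
  assumes "S \<subseteq> J \<or> S \<subseteq> K"
  shows "entropic_vector (glue J K p) S = entropic_vector p S"
  using assms by (auto simp: entropic_vector_def marginal_glue_left marginal_glue_right)

lemma prob_cylinder_glue_eq:
  assumes "S \<subseteq> J \<or> S \<subseteq> K"
  shows "measure (glue J K p) (cylinder S x) = measure p (cylinder S x)"
  using assms marginal_glue_left marginal_glue_right by (metis pmf_marginal)

text \<open>The averaging law \<open>q\<close> is left free: \<open>q = glue J K p\<close> gives the
  entropy of the glued law, \<open>q = p\<close> the cross-entropy behind submodularity.\<close>

lemma expectation_log_glue:
  fixes p q :: "('n \<Rightarrow> nat) pmf"
  assumes fin: "finite (set_pmf q)"
    and pos: "\<And>x S. x \<in> set_pmf q \<Longrightarrow> S \<subseteq> J \<or> S \<subseteq> K \<Longrightarrow> 0 < measure p (cylinder S x)"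
  shows "measure_pmf.expectation q (\<lambda>x. log 2 (measure (glue J K p) (cylinder (J \<union> K) x))) =
    measure_pmf.expectation q (\<lambda>x. log 2 (measure p (cylinder J x))) +
    measure_pmf.expectation q (\<lambda>x. log 2 (measure p (cylinder K x))) -
    measure_pmf.expectation q (\<lambda>x. log 2 (measure p (cylinder (J \<inter> K) x)))"
proof -
  have int: "integrable q f" for f :: "('n \<Rightarrow> nat) \<Rightarrow> real"
    using fin by (rule integrable_measure_pmf_finite)
  have "measure_pmf.expectation q (\<lambda>x. log 2 (measure (glue J K p) (cylinder (J \<union> K) x))) =
    measure_pmf.expectation q (\<lambda>x. log 2 (measure p (cylinder J x)) +
      log 2 (measure p (cylinder K x)) - log 2 (measure p (cylinder (J \<inter> K) x)))"
  proof (rule integral_cong_AE)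
    show "AE x in q. log 2 (measure (glue J K p) (cylinder (J \<union> K) x)) =
        log 2 (measure p (cylinder J x)) + log 2 (measure p (cylinder K x)) -
        log 2 (measure p (cylinder (J \<inter> K) x))"
      unfolding AE_measure_pmf_iff
    proof
      fix x assume x: "x \<in> set_pmf q"
      have "0 < measure p (cylinder J x)" "0 < measure p (cylinder K x)"
        "0 < measure p (cylinder (J \<inter> K) x)"
        using pos[OF x] by auto
      then show "log 2 (measure (glue J K p) (cylinder (J \<union> K) x)) =
        log 2 (measure p (cylinder J x)) + log 2 (measure p (cylinder K x)) -
        log 2 (measure p (cylinder (J \<inter> K) x))"
        by (simp add: prob_cylinder_glue log_mult log_divide)
    qed
  qed auto
  then show ?thesis by (simp add: int)
qed

lemma entropic_vector_glue:
  assumes fin: "finite (set_pmf p)"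
  shows "entropic_vector (glue J K p) (J \<union> K) =
    entropic_vector p J + entropic_vector p K - entropic_vector p (J \<inter> K)"
proof -
  let ?q = "glue J K p"
  have finq: "finite (set_pmf ?q)" using fin by (rule finite_set_glue)
  have H: "measure_pmf.expectation ?q (\<lambda>x. log 2 (measure p (cylinder S x))) = - entropic_vector p S"
    if "S \<subseteq> J \<or> S \<subseteq> K" for S
    using that entropic_vector_eq_expectation[OF finq, of S]
    by (simp add: prob_cylinder_glue_eq entropic_vector_glue_eq)
  have pos: "0 < measure p (cylinder S x)" if "x \<in> set_pmf ?q" "S \<subseteq> J \<or> S \<subseteq> K" for x S
    using prob_cylinder_pos[OF that(1), of S] prob_cylinder_glue_eq[OF that(2)] by simp
  have "measure_pmf.expectation ?q (\<lambda>x. log 2 (measure ?q (cylinder (J \<union> K) x))) =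
    - entropic_vector p J + - entropic_vector p K - - entropic_vector p (J \<inter> K)"
    using expectation_log_glue[OF finq pos] by (simp add: H)
  then show ?thesis by (simp add: entropic_vector_eq_expectation[OF finq])
qed

section \<open>Gibbs' inequality and submodularity of entropy\<close>

text \<open>Apply ln t \<le> t - 1 to t = Q/P and sum over the support of \<open>P\<close>, where
  \<open>Q\<close> has mass at most 1.\<close>

lemma gibbs_inequality:
  assumes fin: "finite (set_pmf P)" and pos: "\<And>x. x \<in> set_pmf P \<Longrightarrow> 0 < pmf Q x"
  shows "measure_pmf.expectation P (\<lambda>x. log 2 (pmf Q x)) \<le>
    measure_pmf.expectation P (\<lambda>x. log 2 (pmf P x))"
proof -
  have le: "pmf P x * log 2 (pmf Q x) - pmf P x * log 2 (pmf P x) \<le> (pmf Q x - pmf P x) / ln 2"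
    if x: "x \<in> set_pmf P" for x
  proof -
    have P: "0 < pmf P x" and Q: "0 < pmf Q x"
      using x pos by (auto simp: pmf_positive)
    have "ln (pmf Q x / pmf P x) \<le> pmf Q x / pmf P x - 1"
      using P Q by (intro ln_le_minus_one) simp
    then have "pmf P x * (ln (pmf Q x) - ln (pmf P x)) \<le> pmf Q x - pmf P x"
      using P Q by (simp add: ln_div field_simps)
    then have "pmf P x * (ln (pmf Q x) - ln (pmf P x)) / ln 2 \<le> (pmf Q x - pmf P x) / ln 2"
      by (intro divide_right_mono) auto
    then show ?thesis
      by (simp add: log_def right_diff_distrib diff_divide_distrib)
  qed
  have "(\<Sum>x\<in>set_pmf P. pmf P x * log 2 (pmf Q x)) - (\<Sum>x\<in>set_pmf P. pmf P x * log 2 (pmf P x))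
      \<le> (\<Sum>x\<in>set_pmf P. (pmf Q x - pmf P x) / ln 2)"
    unfolding sum_subtractf[symmetric] by (intro sum_mono le)
  also have "\<dots> = (measure Q (set_pmf P) - 1) / ln 2"
    using fin by (simp add: sum_subtractf sum_pmf_eq_1 measure_measure_pmf_finite flip: sum_divide_distrib)
  also have "\<dots> \<le> 0"
    by (simp add: divide_nonpos_pos)
  finally show ?thesis
    using fin by (simp add: integral_measure_pmf[OF fin])
qed

text \<open>Gibbs' inequality compares the marginal of \<open>p\<close> on
  \<open>J \<union> K\<close> with that of the glued law. The cross-entropy is H(J) + H(K) - H(J
  \<inter> K), since the glued probabilities factor.\<close>

lemma entropic_vector_submodular:
  assumes fin: "finite (set_pmf p)"
  shows "entropic_vector p (J \<union> K) + entropic_vector p (J \<inter> K) \<le> entropic_vector p J + entropic_vector p K"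
proof -
  have "measure_pmf.expectation (marginal p (J \<union> K)) (\<lambda>x. log 2 (pmf (marginal (glue J K p) (J \<union> K)) x))
    \<le> measure_pmf.expectation (marginal p (J \<union> K)) (\<lambda>x. log 2 (pmf (marginal p (J \<union> K)) x))"
    by (rule gibbs_inequality)
      (use fin in \<open>auto simp: pmf_marginal prob_cylinder_glue prob_cylinder_pos simp del: pmf_map\<close>)
  then show ?thesis
    using fin expectation_log_glue[OF fin prob_cylinder_pos, of J K]
    by (simp add: pmf_marginal entropic_vector_eq_expectation)
qed

section \<open>The five-variable inequality on the entropy region\<close>

text \<open>Right-hand side minus left-hand side of
  I(a:b) \<le> I(a:b|c) + I(a:b|d) + I(c:d) + I(a:b|e) + I(a:e|b) + I(b:e|a), expanded into entropies.\<close>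
definition mmrv_gap :: "('n set \<Rightarrow> real) \<Rightarrow> 'n \<Rightarrow> 'n \<Rightarrow> 'n \<Rightarrow> 'n \<Rightarrow> 'n \<Rightarrow> real" where
  "mmrv_gap h a b c d e = h {a,c} + h {b,c} + h {a,d} + h {b,d} - h {a,b,c} - h {a,b,d} - h {c,d}
     + 2 * h {a,e} + 2 * h {b,e} + 3 * h {a,b} - 3 * h {a,b,e} - h {e} - 2 * h {a} - 2 * h {b}"

lemma mmrv_gap_nonneg_entropic:
  assumes fin: "finite (set_pmf p)" and dist: "distinct [a, b, c, d, e]"
  shows "0 \<le> mmrv_gap (entropic_vector p) a b c d e"
proof -
  define q where "q = glue (- {e}) {a,b,e} p"
  define h where "h = entropic_vector q"
  have finq: "finite (set_pmf q)"
    unfolding q_def using fin by (rule finite_set_glue)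
  \<comment> \<open>Every set occurring in \<open>mmrv_gap\<close> is of one of these two kinds, so
    \<open>p\<close> and \<open>q\<close> have the same gap.\<close>
  have h_eq: "entropic_vector p S = h S" if "(\<forall>x\<in>S. x \<noteq> e) \<or> S \<subseteq> {a,b,e}" for S
    unfolding h_def q_def using that by (subst entropic_vector_glue_eq) auto
  have sub: "h U + h V \<le> h J + h K" if "J \<union> K = U" "J \<inter> K = V" for J K U V
    using entropic_vector_submodular[OF finq, of J K] that by (simp add: h_def)
  have "- {e} \<union> {a,b,e} = UNIV" "- {e} \<inter> {a,b,e} = {a,b}" using dist by auto
  then have "h UNIV = h (- {e}) + h {a,b,e} - h {a,b}"
    using entropic_vector_glue[OF fin, of "- {e}" "{a,b,e}"] by (simp add: h_eq) (simp add: h_def q_def)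
  \<comment> \<open>Drops the other variables: with the preceding equation,
    \<open>h {a,b,c,d} + h {a,b,e} - h {a,b} \<le> h {a,b,c,d,e}\<close>.\<close>
  moreover have "h UNIV + h {a,b,c,d} \<le> h (- {e}) + h {a,b,c,d,e}"
    by (rule sub) (use dist in auto)
  moreover have "h {a,b,c,d,e} + h {a,b,c} \<le> h {a,b,c,d} + h {a,b,c,e}"
    by (rule sub) (use dist in auto)
  moreover have "h {a,b,c,d,e} + h {a,b,d} \<le> h {a,b,c,d} + h {a,b,d,e}"
    by (rule sub) (use dist in auto)
  moreover have "h {a,b,c,e} + h {c,e} \<le> h {a,c,e} + h {b,c,e}"
    by (rule sub) (use dist in auto)
  moreover have "h {a,b,d,e} + h {d,e} \<le> h {a,d,e} + h {b,d,e}"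
    by (rule sub) (use dist in auto)
  moreover have "h {a,c,e} + h {a} \<le> h {a,c} + h {a,e}"
    by (rule sub) (use dist in auto)
  moreover have "h {b,c,e} + h {b} \<le> h {b,c} + h {b,e}"
    by (rule sub) (use dist in auto)
  moreover have "h {a,d,e} + h {a} \<le> h {a,d} + h {a,e}"
    by (rule sub) (use dist in auto)
  moreover have "h {b,d,e} + h {b} \<le> h {b,d} + h {b,e}"
    by (rule sub) (use dist in auto)
  moreover have "h {c,d,e} + h {e} \<le> h {c,e} + h {d,e}"
    by (rule sub) (use dist in auto)
  moreover have "h {a,b,c,d,e} + h {c,d} \<le> h {a,b,c,d} + h {c,d,e}"
    by (rule sub) (use dist in auto)
  \<comment> \<open>The bound from conditional independence enters with weight three, the ten
    submodularities after it with weight one each.\<close>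
  ultimately have "0 \<le> mmrv_gap h a b c d e"
    unfolding mmrv_gap_def by linarith
  then show ?thesis
    using dist by (simp add: mmrv_gap_def h_eq)
qed

lemma mmrv_gap_nonneg:
  fixes h :: "'n::finite set \<Rightarrow> real"
  assumes "h \<in> entropy_region" "distinct [a, b, c, d, e]"
  shows "0 \<le> mmrv_gap h a b c d e"
proof -
  let ?S = "{h :: 'n set \<Rightarrow> real. 0 \<le> mmrv_gap h a b c d e}"
  have "closed ?S"
    unfolding mmrv_gap_def by (intro closed_Collect_le continuous_intros continuous_on_product_coordinates)
  moreover have "entropic_vectors \<subseteq> ?S"
    using assms(2) by (auto simp: entropic_vectors_def intro!: mmrv_gap_nonneg_entropic)
  ultimately show ?thesis
    using assms(1) closure_minimal unfolding entropy_region_def by blast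
qed

section \<open>The dual inequality and its violation\<close>

text \<open>The coefficients of \<open>mmrv_gap\<close> sum to zero, both over all its sets and over
  those containing any given element, so \<open>h UNIV\<close> and the singleton terms of the dual
  cancel.\<close>

lemma mmrv_gap_dual_vec:
  assumes "distinct [a, b, c, d, e]"
  shows "mmrv_gap (dual_vec h) a b c d e =
    h (- {a,c}) + h (- {b,c}) + h (- {a,d}) + h (- {b,d}) - h (- {a,b,c}) - h (- {a,b,d}) - h (- {c,d})
    + 2 * h (- {a,e}) + 2 * h (- {b,e}) + 3 * h (- {a,b}) - 3 * h (- {a,b,e}) - h (- {e})
    - 2 * h (- {a}) - 2 * h (- {b})"
  using assms by (simp add: mmrv_gap_def dual_vec_def Compl_eq_Diff_UNIV)

text \<open>The cylinder through \<open>X k\<close> has probability proportional to the number of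
  indices agreeing with \<open>k\<close> on \<open>J\<close>, so entropies reduce to
  counting.\<close>

lemma entropic_vector_uniform:
  fixes X :: "'k \<Rightarrow> 'n \<Rightarrow> nat"
  assumes "finite A" "A \<noteq> {}"
  shows "entropic_vector (map_pmf X (pmf_of_set A)) J =
    log 2 (card A) - (\<Sum>k\<in>A. log 2 (card {l\<in>A. \<forall>i\<in>J. X l i = X k i})) / card A"
proof -
  have pos: "0 < card {l\<in>A. \<forall>i\<in>J. X l i = X k i}" if "k \<in> A" for k
    using that assms by (subst card_gt_0_iff) auto
  have m: "measure (map_pmf X (pmf_of_set A)) (cylinder J (X k)) =
    real (card {l\<in>A. \<forall>i\<in>J. X l i = X k i}) / real (card A)" for k
    using assms by (simp add: measure_pmf_of_set cylinder_def vimage_def Int_def)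
  have "entropic_vector (map_pmf X (pmf_of_set A)) J =
    - (\<Sum>k\<in>A. log 2 (card {l\<in>A. \<forall>i\<in>J. X l i = X k i} / card A)) / card A"
    using assms by (subst entropic_vector_eq_expectation)
      (auto simp: m integral_pmf_of_set simp del: measure_map_pmf)
  also have "(\<Sum>k\<in>A. log 2 (card {l\<in>A. \<forall>i\<in>J. X l i = X k i} / card A)) =
    (\<Sum>k\<in>A. log 2 (card {l\<in>A. \<forall>i\<in>J. X l i = X k i}) - log 2 (card A))"
  proof (rule sum.cong)
    fix k assume "k \<in> A"
    then show "log 2 (card {l\<in>A. \<forall>i\<in>J. X l i = X k i} / card A) =
        log 2 (card {l\<in>A. \<forall>i\<in>J. X l i = X k i}) - log 2 (card A)"
      using pos[of k] assms card_gt_0_iff[of A] by (intro log_divide_pos) simp_all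
  qed simp
  finally show ?thesis
    using assms by (simp add: sum_subtractf field_simps)
qed


lemma mmrv_gap_dual_neg:
  fixes a b c d e :: "'n::finite"
  assumes dist: "distinct [a, b, c, d, e]"
  shows "\<exists>h \<in> entropic_vectors. mmrv_gap (dual_vec h) a b c d e < 0"
proof -
  \<comment> \<open>The eight atoms are the values of the independent fair bits e, a, b. Given e = 0 we have
    c = min a b and d = max a b; given e = 1 the same holds after flipping b, except that the
    values c = 1 and d = 0 are renamed to 2. So knowing c and d either fixes a, b and e or
    leaves a and b uniform with e determined by whether a = b.\<close>
  define X :: "nat \<Rightarrow> 'n \<Rightarrow> nat" where "X k i =
    (if i = a then [0,0,1,1,0,0,1,1] ! k else if i = b then [0,1,0,1,0,1,0,1] ! k
     else if i = c then [0,0,0,1,0,0,2,0] ! k else if i = d then [0,1,1,1,1,2,1,1] ! k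
     else if i = e then [0,0,0,0,1,1,1,1] ! k else 0)" for k i
  define h where "h = entropic_vector (map_pmf X (pmf_of_set {..<8}))"
  have X: "X k a = [0,0,1,1,0,0,1,1] ! k" "X k b = [0,1,0,1,0,1,0,1] ! k"
    "X k c = [0,0,0,1,0,0,2,0] ! k" "X k d = [0,1,1,1,1,2,1,1] ! k"
    "X k e = [0,0,0,0,1,1,1,1] ! k" for k
    using dist by (auto simp: X_def)
  have X0: "X k i = 0" if "i \<notin> {a,b,c,d,e}" for i k
    using that by (simp add: X_def)
  have logs: "log 2 (8::real) = 3" "log 2 (4::real) = 2"
    using log_pow_cancel[of 2 3] log_pow_cancel[of 2 2] by simp_all
  \<comment> \<open>Coordinates outside the five are constant, so only \<open>T\<close> matters. The
    explicit lists let each entropy be evaluated by simplification.\<close>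
  have h: "h (- S) = 3 - (\<Sum>k\<leftarrow>[0,1,2,3,4,5,6,7].
      log 2 (length (filter (\<lambda>l. \<forall>i\<in>T. X l i = X k i) [0,1,2,3,4,5,6,7]))) / 8"
    if "{a,b,c,d,e} - S = T" for S T
  proof -
    have eq: "(\<forall>i\<in>-S. X l i = X k i) \<longleftrightarrow> (\<forall>i\<in>T. X l i = X k i)" for k l
      using that X0[of _ l] X0[of _ k] by (metis Compl_iff Diff_iff)
    have card: "card {l. l < 8 \<and> P l} = length (filter P [0..<8])" for P
      by (subst distinct_card[symmetric]) (auto intro!: arg_cong[where f=card])
    have "[0,1,2,3,4,5,6,7] = [0..<8::nat]"
      by (simp add: upt_conv_Cons)
    then show ?thesis
      unfolding h_def
      by (subst entropic_vector_uniform)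
        (simp_all add: eq card logs lessThan_empty_iff atLeast0LessThan
          interv_sum_list_conv_sum_set_nat)
  qed
  have "h (- {a,c}) = 5/2"
    by (subst h[of _ "{b,d,e}"], use dist in force) (simp add: X logs)
  moreover have "h (- {b,c}) = 5/2"
    by (subst h[of _ "{a,d,e}"], use dist in force) (simp add: X logs)
  moreover have "h (- {a,d}) = 5/2"
    by (subst h[of _ "{b,c,e}"], use dist in force) (simp add: X logs)
  moreover have "h (- {b,d}) = 5/2"
    by (subst h[of _ "{a,c,e}"], use dist in force) (simp add: X logs)
  \<comment> \<open>For each value of \<open>e\<close>, \<open>d\<close> takes one value on three
    atoms and another on the fourth. So six of the eight atoms lie in classes of size 3; likewise
    for \<open>c\<close>.\<close>
  moreover have "h (- {a,b,c}) = 3 - 3/4 * log 2 3"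
    by (subst h[of _ "{d,e}"], use dist in force) (simp add: X logs)
  moreover have "h (- {a,b,d}) = 3 - 3/4 * log 2 3"
    by (subst h[of _ "{c,e}"], use dist in force) (simp add: X logs)
  moreover have "h (- {c,d}) = 3"
    by (subst h[of _ "{a,b,e}"], use dist in force) (simp add: X logs)
  moreover have "h (- {a,e}) = 5/2"
    by (subst h[of _ "{b,c,d}"], use dist in force) (simp add: X logs)
  moreover have "h (- {b,e}) = 5/2"
    by (subst h[of _ "{a,c,d}"], use dist in force) (simp add: X logs)
  moreover have "h (- {a,b}) = 5/2"
    by (subst h[of _ "{c,d,e}"], use dist in force) (simp add: X logs)
  moreover have "h (- {a,b,e}) = 2"
    by (subst h[of _ "{c,d}"], use dist in force) (simp add: X logs)
  moreover have "h (- {e}) = 3"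
    by (subst h[of _ "{a,b,c,d}"], use dist in force) (simp add: X logs)
  moreover have "h (- {a}) = 3"
    by (subst h[of _ "{b,c,d,e}"], use dist in force) (simp add: X logs)
  moreover have "h (- {b}) = 3"
    by (subst h[of _ "{a,c,d,e}"], use dist in force) (simp add: X logs)
  ultimately have "mmrv_gap (dual_vec h) a b c d e = 3/2 * log 2 3 - 5/2"
    using dist by (simp add: mmrv_gap_dual_vec)
  \<comment> \<open>The gap is negative because 27 < 32.\<close>
  moreover have "log 2 3 < 5/3"
  proof -
    have "3 * log 2 3 = log 2 (3 ^ 3)"
      by (simp only: log_nat_power)
    also have "\<dots> < log 2 (2 ^ 5)"
      by (subst log_less_cancel_iff) auto
    also have "\<dots> = 5"
      by (simp only: log_nat_power) simp
    finally show ?thesis by simp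
  qed
  moreover have "h \<in> entropic_vectors"
    unfolding h_def entropic_vectors_def by (auto simp: lessThan_empty_iff)
  ultimately show ?thesis
    by (intro bexI[of _ h]) auto
qed

theorem mainTheorem1:
  assumes "CARD('n::finite) \<ge> 5"
  shows "\<exists>h \<in> (entropy_region :: ('n set \<Rightarrow> real) set). dual_vec h \<notin> entropy_region"
proof -
  obtain T :: "'n set" where "card T = 5"
    using obtain_subset_with_card_n[OF assms] by metis
  then obtain xs :: "'n list" where "length xs = 5" "distinct xs"
    using finite_distinct_list[of T] by (metis distinct_card finite)
  then obtain a b c d e :: 'n where dist: "distinct [a, b, c, d, e]"
    by (auto simp: numeral_eq_Suc length_Suc_conv)
  obtain h :: "'n set \<Rightarrow> real" where "h \<in> entropic_vectors" "mmrv_gap (dual_vec h) a b c d e < 0"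
    using mmrv_gap_dual_neg[OF dist] by blast
  then have "h \<in> entropy_region" "dual_vec h \<notin> entropy_region"
    using closure_subset mmrv_gap_nonneg[OF _ dist, of "dual_vec h"]
    unfolding entropy_region_def by (blast, linarith)
  then show ?thesis by blast
qed

end
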